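(* Let $m,s\ge1$ be integers, let $C_1,\dots,C_s\in\{0,1\}^{m\times m}$, and let $\boldsymbol{x}_0,\dots,\boldsymbol{x}_{2^m-1}\in[0,1)^s$ be the digital net in base $2$ generated by $C_1,\dots,C_s$. For any nonempty $u\subseteq\{1,\dots,s\}$ such that $C_{u,\mathbf{1}_u}$ has full row rank, $$\max_{\boldsymbol{k}\in\mathbb{N}_0^{|u|}}\Gamma_{u,\boldsymbol{k}}\le 2^{t_u^*+|u|-1}\quad\text{and}\quad \max_{\emptyset\ne v\subseteq u}\ \max_{\boldsymbol{k}\in\mathbb{N}_0^{|v|}}\Gamma_{v,\boldsymbol{k}}=2^{t_u^*+|u|-1}.$$
   Context: All matrix and vector arithmetic on bits, and all ranks, are over the field $\mathbb{Z}_2$. $\mathbb{N}_0$ is the set of non-negative integers. Digital net: for an integer $0\le i<2^m$ with $i=\sum_{\ell=1}^m i_\ell2^{\ell-1}$, $i_\ell\in\{0,1\}$, let $\vec{i}=(i_1,\dots,i_m)^{\mathsf T}$. The digital net generated by $C_1,\dots,C_s$ is $\boldsymbol{x}_i=(x_{i1},\dots,x_{is})$ with $x_{ij}=\sum_{\ell=1}^m x_{ij\ell}2^{-\ell}$, where $(x_{ij1},\dots,x_{ijm})^{\mathsf T}=C_j\vec{i}$ mod $2$. Matrices: $C_j(\ell,:)$ denotes row $\ell$ of $C_j$, with the convention that $C_j(\ell,:)$ is the zero row of length $m$ for $\ell>m$. For nonempty $u\subseteq\{1,\dots,s\}$ and $\boldsymbol{k}=(k_j)_{j\in u}\in\mathbb{N}_0^{|u|}$,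 $C_{u,\boldsymbol{k}}$ is the matrix with $|\boldsymbol{k}|=\sum_{j\in u}k_j$ rows and $m$ columns obtained by stacking the rows $C_j(\ell,:)$, $1\le\ell\le k_j$, for $j\in u$. "Full rank" means full row rank, i.e. $\mathrm{rank}(C_{u,\boldsymbol{k}})=|\boldsymbol{k}|$. $\mathbf{1}_u=(1,\dots,1)\in\mathbb{N}_0^{|u|}$. The parameter $t_u^*$: for nonempty $u\subseteq\{1,\dots,s\}$, $$t_u^*=m+1-\min\bigl\{|\boldsymbol{k}| : \boldsymbol{k}\in\mathbb{N}_0^{|u|},\ \boldsymbol{k}\ge\mathbf{1}_u\text{ componentwise},\ C_{u,\boldsymbol{k}}\text{ not of full rank}\bigr\}.$$ Gain coefficients: let $n=2^m$. For $x,x'\in[0,1)$ let $M(x,x')=\max\{k\in\mathbb{N}_0: \lfloor 2^kx\rfloor=\lfloor 2^kx'\rfloor\}\in\mathbb{N}_0\cup\{\infty\}$ (equal to $\infty$ when $x=x'$). For nonempty $u\subseteq\{1,\dots,s\}$, $\boldsymbol{k}=(k_j)_{j\in u}\in\mathbb{N}_0^{|u|}$, $j\in u$ and $0\le i,i'<n$, put $N_{i,i',j}=0$ if $M(x_{ij},x_{i'j})<k_j$, $-1$ if $M(x_{ij},x_{i'j})=k_j$, and $1$ if $M(x_{ij},x_{i'j})>k_j$. Then $\Gamma_{u,\boldsymbol{k}}=\frac1n\sum_{i=0}^{n-1}\sum_{i'=0}^{n-1}\prod_{j\in u}N_{i,i',j}$. *)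

theory Defs
  imports
    Complex_Main
    "HOL-Library.FuncSet"
    "HOL-Library.Extended_Nat"
    "HOL-Library.Z2"
    "Jordan_Normal_Form.DL_Rank"
begin

text \<open>
  The generator matrices are given by a family \<open>C :: nat \<Rightarrow> bit mat\<close>, indexed by \<open>1, \<dots>, s\<close>, of
  matrices over the two-element field \<open>bit\<close>. Rows and bits are numbered from 1 as in the
  mathematics; the entries of library matrices and vectors are numbered from 0. Elements of
  \<open>\<nat>\<^sub>0\<^sup>u\<close> are the extensional functions \<open>k \<in> u \<rightarrow>\<^sub>E UNIV\<close>.
\<close>

subsection \<open>Digital nets\<close>

definition bits_vec :: "nat \<Rightarrow> nat \<Rightarrow> bit vec" where
  "bits_vec m i = vec m (\<lambda>l. of_bool (odd (i div 2 ^ l)))"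

definition net_point :: "nat \<Rightarrow> (nat \<Rightarrow> bit mat) \<Rightarrow> nat \<Rightarrow> nat \<Rightarrow> real" where
  "net_point m C i j =
     (\<Sum>l = 1..m. of_bool ((C j *\<^sub>v bits_vec m i) $ (l - 1) = 1) / 2 ^ l)"

subsection \<open>Stacked matrices and the parameter \<open>t\<^sub>u\<^sup>*\<close>\<close>

definition gen_row :: "nat \<Rightarrow> bit mat \<Rightarrow> nat \<Rightarrow> bit vec" where
  "gen_row m A l = (if l \<le> m then row A (l - 1) else 0\<^sub>v m)"

definition stacked_mat :: "nat \<Rightarrow> (nat \<Rightarrow> bit mat) \<Rightarrow> nat set \<Rightarrow> (nat \<Rightarrow> nat) \<Rightarrow> bit mat" where
  "stacked_mat m C u k =
     mat_of_rows m (concat (map (\<lambda>j. map (gen_row m (C j)) [1..<k j + 1]) (sorted_list_of_set u)))"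

text \<open>The library's rank takes the number of rows of the matrix as a parameter.\<close>

definition full_row_rank :: "nat \<Rightarrow> (nat \<Rightarrow> bit mat) \<Rightarrow> nat set \<Rightarrow> (nat \<Rightarrow> nat) \<Rightarrow> bool" where
  "full_row_rank m C u k \<longleftrightarrow> vec_space.rank (\<Sum>j\<in>u. k j) (stacked_mat m C u k) = (\<Sum>j\<in>u. k j)"

definition t_star :: "nat \<Rightarrow> (nat \<Rightarrow> bit mat) \<Rightarrow> nat set \<Rightarrow> int" where
  "t_star m C u = int m + 1 -
     int (LEAST c. \<exists>k \<in> u \<rightarrow>\<^sub>E UNIV. (\<forall>j\<in>u. 1 \<le> k j) \<and> \<not> full_row_rank m C u k \<and> (\<Sum>j\<in>u. k j) = c)"

subsection \<open>Gain coefficients\<close>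

text \<open>On a nonempty finite set of extended naturals, \<open>Sup\<close> is the maximum; on an infinite one it
  is \<open>\<infinity>\<close>. The set below always contains \<open>0\<close> when both arguments lie in \<open>[0, 1)\<close>.\<close>

definition common_bits :: "real \<Rightarrow> real \<Rightarrow> enat" where
  "common_bits x y = Sup {enat k |k. \<lfloor>2 ^ k * x\<rfloor> = \<lfloor>2 ^ k * y\<rfloor>}"

definition gain_factor :: "real \<Rightarrow> real \<Rightarrow> nat \<Rightarrow> real" where
  "gain_factor x y k =
     (if common_bits x y < enat k then 0 else if common_bits x y = enat k then - 1 else 1)"

definition gain :: "nat \<Rightarrow> (nat \<Rightarrow> bit mat) \<Rightarrow> nat set \<Rightarrow> (nat \<Rightarrow> nat) \<Rightarrow> real" where
  "gain m C u k = 1 / 2 ^ m *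
     (\<Sum>i<2 ^ m. \<Sum>i'<2 ^ m. \<Prod>j\<in>u. gain_factor (net_point m C i j) (net_point m C i' j) (k j))"

subsection \<open>The minimum and the maxima are attained\<close>

lemma length_stacked_rows:
  assumes "finite u"
  shows "length (concat (map (\<lambda>j. map (gen_row m (C j)) [1..<k j + 1]) (sorted_list_of_set u)))
    = (\<Sum>j\<in>u. k j)"
  using assms
  by (simp add: length_concat comp_def sum_list_distinct_conv_sum_set del: upt_Suc)

lemma stacked_mat_carrier:
  assumes "finite u"
  shows "stacked_mat m C u k \<in> carrier_mat (\<Sum>j\<in>u. k j) m"
  using length_stacked_rows[OF assms, of m C k] unfolding stacked_mat_def
  by (metis mat_of_rows_carrier(1))

lemma ex_not_full_row_rank:
  assumes "finite u" "u \<noteq> {}"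
  shows "\<exists>k \<in> u \<rightarrow>\<^sub>E UNIV. (\<forall>j\<in>u. 1 \<le> k j) \<and> \<not> full_row_rank m C u k"
proof -
  define k where "k = restrict (\<lambda>_. m + 1) u"
  have sum: "(\<Sum>j\<in>u. k j) = card u * (m + 1)"
    by (simp add: k_def)
  have "card u \<ge> 1"
    using assms by (simp add: Suc_le_eq card_gt_0_iff)
  then have "card u * (m + 1) \<ge> 1 * (m + 1)"
    by (rule mult_le_mono1)
  then have "m < (\<Sum>j\<in>u. k j)"
    using sum by simp
  moreover have "vec_space.rank (\<Sum>j\<in>u. k j) (stacked_mat m C u k) \<le> m"
    by (rule vec_space.rank_le_nc[OF stacked_mat_carrier[OF assms(1)]])
  ultimately have "\<not> full_row_rank m C u k"
    unfolding full_row_rank_def by linarith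
  then show ?thesis
    by (intro bexI[of _ k]) (auto simp: k_def)
qed

lemma finite_range_gain: "finite (range (gain m C u))"
proof -
  let ?N = "2 ^ m * 2 ^ m :: int"
  have "gain m C u k \<in> (\<lambda>z. 1 / 2 ^ m * of_int z) ` {- ?N..?N}" for k
  proof -
    define g :: "real \<Rightarrow> real \<Rightarrow> nat \<Rightarrow> int" where
      "g x y k = (if common_bits x y < enat k then 0 else if common_bits x y = enat k then - 1 else 1)"
      for x y k
    have g: "gain_factor x y k = of_int (g x y k)" "\<bar>g x y k\<bar> \<le> 1" for x y k
      by (auto simp: g_def gain_factor_def)
    let ?p = "\<lambda>i i'. \<Prod>j\<in>u. g (net_point m C i j) (net_point m C i' j) (k j)"
    have p: "\<bar>?p i i'\<bar> \<le> 1" for i i'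
      by (auto simp: abs_prod intro!: prod_le_1 g(2))
    have "\<bar>\<Sum>i<2 ^ m. \<Sum>i'<2 ^ m. ?p i i'\<bar> \<le> (\<Sum>i<(2::nat) ^ m. \<Sum>i'<(2::nat) ^ m. 1)"
      by (intro order.trans[OF sum_abs] sum_mono order.trans[OF sum_abs] p)
    also have "\<dots> = ?N"
      by simp
    finally have "(\<Sum>i<2 ^ m. \<Sum>i'<2 ^ m. ?p i i') \<in> {- ?N..?N}"
      by auto
    moreover have "gain m C u k = 1 / 2 ^ m * of_int (\<Sum>i<2 ^ m. \<Sum>i'<2 ^ m. ?p i i')"
      by (simp add: gain_def g(1))
    ultimately show ?thesis
      by blast
  qed
  then have "range (gain m C u) \<subseteq> (\<lambda>z. 1 / 2 ^ m * of_int z) ` {- ?N..?N}"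
    by blast
  then show ?thesis
    by (rule finite_subset) simp
qed

lemma finite_gain_image: "finite (gain m C u ` K)"
  by (rule finite_subset[OF _ finite_range_gain]) auto

end

theory Submission
  imports Defs
begin

text \<open>
  Over \<open>\<int>\<^sub>2\<close>, the gain factor of coordinate \<open>j\<close> at depth \<open>k\<^sub>j\<close> depends only on the digit difference
  \<open>v\<close> of \<open>i\<close> and \<open>i'\<close>: it is the product of the indicators that the first \<open>k\<^sub>j\<close> rows of \<open>C\<^sub>j\<close>
  annihilate \<open>v\<close> and of the sign \<open>(-1)\<close> to the power of the next row applied to \<open>v\<close>. Expanding the
  indicators into signs and summing over \<open>v\<close> shows that \<open>\<Gamma>\<close> at \<open>(u, k)\<close> is \<open>2\<close> to the power
  \<open>m - |k|\<close> times the number of linear relations among the rows of index at most \<open>k\<^sub>j + 1\<close> in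
  which all last rows \<open>(j, k\<^sub>j + 1)\<close> occur.

  Let \<open>\<kappa>\<close> be the minimal \<open>|k|\<close> in the definition of \<open>t\<^sub>u\<^sup>*\<close>, so that the claimed value is \<open>2\<close> to the
  power \<open>m + |u| - \<kappa>\<close>. If such a relation exists, then \<open>|k| \<ge> \<kappa> - |u|\<close>; a sub-multiindex of size
  \<open>\<kappa> - |u|\<close> has independent rows, and a relation is determined by its part outside these, so there
  are at most \<open>2\<close> to the power \<open>|k| - \<kappa> + |u|\<close> of them. Conversely, for a minimizer \<open>k\<close> take a relation; by
  minimality it contains every last row \<open>(j, k\<^sub>j)\<close> with \<open>k\<^sub>j \<ge> 2\<close>, so the bound is attained on the set
  of those \<open>j\<close> whose last row occurs, at the multiindex \<open>k - 1\<close>.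
\<close>

subsection \<open>Row rank and linear relations\<close>

text \<open>A vector orthogonal to all columns is a linear relation between the rows. The rank is
  the size of a maximal independent set \<open>U\<close> of columns, which spans all columns, so
  only orthogonality to \<open>U\<close> matters; nonzero solutions exist exactly when
  \<open>card U < n\<close>.\<close>

lemma rank_eq_dim_row_iff:
  fixes A :: "'a :: field mat"
  assumes A: "A \<in> carrier_mat n nc"
  shows "vec_space.rank n A = n \<longleftrightarrow>
    (\<forall>y \<in> carrier_vec n. (\<forall>c<nc. y \<bullet> col A c = 0) \<longrightarrow> y = 0\<^sub>v n)"
proof -
  interpret vec_space "TYPE('a)" n .
  let ?S = "set (cols A)"
  have S: "?S \<subseteq> carrier_vec n"
    using cols_dim A by blast
  have orth_cols: "(\<forall>c<nc. y \<bullet> col A c = 0) \<longleftrightarrow> (\<forall>x\<in>?S. y \<bullet> x = 0)" for y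
    using A by (auto simp: cols_def)
  obtain U where U: "maximal U (\<lambda>T. T \<subseteq> ?S \<and> lin_indpt T)" "finite U"
    using maximal_exists_superset[of ?S "\<lambda>T. T \<subseteq> ?S \<and> lin_indpt T" "{}"]
    by (metis (no_types, lifting) List.finite_set empty_subsetI finite_lin_indpt2 empty_iff finite.emptyI)
  then have US: "U \<subseteq> ?S" and ind: "lin_indpt U"
    by (auto simp: maximal_def)
  then have Uc: "U \<subseteq> carrier_vec n"
    using S by blast
  have rank: "rank A = card U"
    using rank_card_indpt[OF A U(1)] .
  have spanU: "?S \<subseteq> span U"
  proof
    fix x assume x: "x \<in> ?S"
    show "x \<in> span U"
    proof (rule ccontr)
      assume nx: "x \<notin> span U"
      then have "x \<notin> U"
        using Uc span_mem by blast
      moreover have "lin_indpt (U \<union> {x})"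
        using nx ind x S lin_dep_iff_in_span[OF Uc ind, of x] \<open>x \<notin> U\<close> by blast
      ultimately show False
        using U(1) x US unfolding maximal_def by blast
    qed
  qed
  have orth_U: "(\<forall>x\<in>?S. y \<bullet> x = 0) \<longleftrightarrow> (\<forall>x\<in>U. y \<bullet> x = 0)" if "y \<in> carrier_vec n" for y
    using in_orthogonal_complement_span[OF Uc] spanU US that
    unfolding orthogonal_complement_def by blast
  show ?thesis
  proof
    assume "rank A = n"
    then have "basis U"
      using dim_li_is_basis[of U] U(2) Uc ind rank by (simp add: dim_is_n)
    then have span: "span U = carrier_vec n"
      by (simp add: basis_def)
    show "\<forall>y \<in> carrier_vec n. (\<forall>c<nc. y \<bullet> col A c = 0) \<longrightarrow> y = 0\<^sub>v n"
    proof (intro ballI impI)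
      fix y :: "'a vec" assume y: "y \<in> carrier_vec n" "\<forall>c<nc. y \<bullet> col A c = 0"
      then have "\<forall>x\<in>U. y \<bullet> x = 0"
        using orth_cols orth_U by blast
      then have "y \<in> orthogonal_complement (carrier_vec n)"
        using in_orthogonal_complement_span[OF Uc] y(1)
        by (simp add: span orthogonal_complement_def)
      then have "\<forall>x\<in>carrier_vec n. y \<bullet> x = 0"
        by (simp add: orthogonal_complement_def)
      then have "y $ i = 0" if "i < n" for i
        using that y(1) scalar_prod_right_unit[of i n y] by (metis unit_vec_carrier)
      then show "y = 0\<^sub>v n"
        using y(1) by (intro eq_vecI) auto
    qed
  next
    assume *: "\<forall>y \<in> carrier_vec n. (\<forall>c<nc. y \<bullet> col A c = 0) \<longrightarrow> y = 0\<^sub>v n"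
    show "rank A = n"
    proof (rule ccontr)
      assume "rank A \<noteq> n"
      moreover have "card U \<le> n"
        using li_le_dim(2)[OF _ Uc ind] by (simp add: dim_is_n)
      ultimately have less: "card U < n"
        using rank by simp
      obtain us where us: "set us = U" "distinct us"
        using U(2) finite_distinct_list by blast
      then have len: "length us = card U"
        using distinct_card by force
      \<comment> \<open>Padding a basis of the column space with zero rows gives a singular square matrix, whose kernel
        contains a nonzero vector orthogonal to all columns of \<open>A\<close>.\<close>
      let ?xs = "us @ replicate (n - card U) (0\<^sub>v n)"
      define M where "M = mat_of_rows n ?xs"
      have lenx: "length ?xs = n"
        using len less by simp
      have M: "M \<in> carrier_mat n n"
        using lenx unfolding M_def by (metis mat_of_rows_carrier(1))
      have rows: "row M i = ?xs ! i" if "i < n" for i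
        using that lenx us Uc unfolding M_def by (intro mat_of_rows_row) (auto simp: nth_append)
      have "det M = 0"
      proof -
        have "row M (n - 1) = 0\<^sub>v n"
          using less len by (subst rows) (auto simp: nth_append)
        then obtain i where i: "i < n" "row M i = 0\<^sub>v n"
          using less that[of "n - 1"] by simp
        have "(\<Prod>j=0..<n. M $$ (j, p j)) = 0" if "p permutes {0..<n}" for p
        proof (rule prod_zero)
          have "p i < n"
            using that i permutes_in_image by fastforce
          then have "M $$ (i, p i) = row M i $ p i"
            using M i(1) by simp
          also have "\<dots> = 0"
            using i(2) \<open>p i < n\<close> by simp
          finally show "\<exists>j\<in>{0..<n}. M $$ (j, p j) = 0"
            using i(1) by (intro bexI[of _ i]) auto
        qed simp
        then show ?thesis
          unfolding det_def'[OF M] by (intro sum.neutral) simp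
      qed
      then obtain v where v: "v \<in> carrier_vec n" "v \<noteq> 0\<^sub>v n" "M *\<^sub>v v = 0\<^sub>v n"
        using det_0_iff_vec_prod_zero_field[OF M] by blast
      have "v \<bullet> x = 0" if x: "x \<in> U" for x
      proof -
        obtain i where i: "i < length us" "us ! i = x"
          using x us(1) by (auto simp: in_set_conv_nth)
        then have "row M i = x"
          using rows[of i] len less by (simp add: nth_append)
        then have "x \<bullet> v = (M *\<^sub>v v) $ i"
          using i len less M by (simp add: mult_mat_vec_def)
        also have "\<dots> = 0"
          using v(3) i len less by simp
        finally show ?thesis
          using v(1) x Uc comm_scalar_prod[of v n x] by auto
      qed
      then have "\<forall>c<nc. v \<bullet> col A c = 0"
        unfolding orth_cols orth_U[OF v(1)] by blast
      then show False
        using * v(1,2) by blast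
    qed
  qed
qed

text \<open>Over the two-element field all coefficients are 0 or 1, so a linear relation is just a
  set of indices.\<close>

definition vanishing_sum :: "nat \<Rightarrow> ('b \<Rightarrow> 'a :: comm_monoid_add vec) \<Rightarrow> 'b set \<Rightarrow> bool" where
  "vanishing_sum m f X \<longleftrightarrow> (\<forall>c<m. (\<Sum>p\<in>X. f p $ c) = 0)"

text \<open>Relations are sets of indices, not of vectors: two equal rows at different indices form
  a relation, and so does a single zero row.\<close>

definition independent_rows :: "nat \<Rightarrow> ('b \<Rightarrow> bit vec) \<Rightarrow> 'b set \<Rightarrow> bool" where
  "independent_rows m f X \<longleftrightarrow> (\<forall>T\<subseteq>X. vanishing_sum m f T \<longrightarrow> T = {})"

text \<open>A coefficient vector \<open>y\<close> over \<open>bit\<close> corresponds to its support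
  \<open>S y\<close>, a subset of \<open>set ps\<close>; distinctness of \<open>ps\<close> makes the
  sum over positions a sum over indices.\<close>

lemma rank_mat_of_rows_eq_length_iff:
  assumes ps: "distinct ps" and f: "\<And>p. p \<in> set ps \<Longrightarrow> f p \<in> carrier_vec m"
  shows "vec_space.rank (length ps) (mat_of_rows m (map f ps)) = length ps \<longleftrightarrow>
    independent_rows m f (set ps)"
proof -
  let ?n = "length ps" and ?A = "mat_of_rows m (map f ps)"
  have A: "?A \<in> carrier_mat ?n m"
    by (metis length_map mat_of_rows_carrier(1))
  define S where "S y = (!) ps ` {i. i < ?n \<and> y $ i = 1}" for y :: "bit vec"
  have inj: "inj_on ((!) ps) {..<?n}"
    using ps by (auto simp: inj_on_def nth_eq_iff_index_eq)
  have S_sum: "y \<bullet> col ?A c = (\<Sum>p\<in>S y. f p $ c)" if "c < m" for y c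
  proof -
    have "y \<bullet> col ?A c = (\<Sum>i<?n. y $ i * f (ps ! i) $ c)"
      using that A by (auto simp: scalar_prod_def mat_of_rows_index atLeast0LessThan intro!: sum.cong)
    also have "\<dots> = (\<Sum>i\<in>{i. i < ?n \<and> y $ i = 1}. f (ps ! i) $ c)"
      by (rule sum.mono_neutral_cong_right) auto
    also have "\<dots> = (\<Sum>p\<in>S y. f p $ c)"
      unfolding S_def by (subst sum.reindex) (auto intro: inj_on_subset[OF inj])
    finally show ?thesis .
  qed
  have van: "(\<forall>c<m. y \<bullet> col ?A c = 0) \<longleftrightarrow> vanishing_sum m f (S y)" for y
    using S_sum by (simp add: vanishing_sum_def)
  have empty: "S y = {} \<longleftrightarrow> y = 0\<^sub>v ?n" if "y \<in> carrier_vec ?n" for y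
    using that unfolding S_def by (auto simp: vec_eq_iff)
  have sub: "S y \<subseteq> set ps" for y
    by (auto simp: S_def)
  have surj: "\<exists>y \<in> carrier_vec ?n. S y = T" if "T \<subseteq> set ps" for T
  proof
    show "vec ?n (\<lambda>i. of_bool (ps ! i \<in> T)) \<in> carrier_vec ?n"
      by simp
    have "{i. i < ?n \<and> vec ?n (\<lambda>i. of_bool (ps ! i \<in> T) :: bit) $ i = 1} = {i. i < ?n \<and> ps ! i \<in> T}"
      by auto
    then have "S (vec ?n (\<lambda>i. of_bool (ps ! i \<in> T))) = {p \<in> set ps. p \<in> T}"
      unfolding S_def by (auto simp: in_set_conv_nth)
    then show "S (vec ?n (\<lambda>i. of_bool (ps ! i \<in> T))) = T"
      using that by blast
  qed
  show ?thesis
    unfolding rank_eq_dim_row_iff[OF A] van independent_rows_def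
  proof (intro iffI allI ballI impI)
    fix T assume *: "\<forall>y\<in>carrier_vec ?n. vanishing_sum m f (S y) \<longrightarrow> y = 0\<^sub>v ?n"
      and T: "T \<subseteq> set ps" "vanishing_sum m f T"
    obtain y where "y \<in> carrier_vec ?n" "S y = T"
      using surj[OF T(1)] by blast
    then show "T = {}"
      using * T(2) empty by blast
  next
    fix y assume "\<forall>T\<subseteq>set ps. vanishing_sum m f T \<longrightarrow> T = {}"
      and "y \<in> carrier_vec ?n" "vanishing_sum m f (S y)"
    then show "y = 0\<^sub>v ?n"
      using sub empty by blast
  qed
qed

abbreviation row_indices :: "nat set \<Rightarrow> (nat \<Rightarrow> nat) \<Rightarrow> (nat \<times> nat) set" where
  "row_indices u k \<equiv> SIGMA j:u. {1..k j}"

abbreviation net_row :: "nat \<Rightarrow> (nat \<Rightarrow> bit mat) \<Rightarrow> nat \<times> nat \<Rightarrow> bit vec" where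
  "net_row m C \<equiv> \<lambda>(j, l). gen_row m (C j) l"

lemma gen_row_carrier:
  assumes "A \<in> carrier_mat m m"
  shows "gen_row m A l \<in> carrier_vec m"
  using assms by (intro carrier_vecI) (simp add: gen_row_def)

lemma full_row_rank_iff:
  assumes "finite u" "\<And>j. j \<in> u \<Longrightarrow> C j \<in> carrier_mat m m"
  shows "full_row_rank m C u k \<longleftrightarrow> independent_rows m (net_row m C) (row_indices u k)"
proof -
  define js where "js = sorted_list_of_set u"
  have js: "distinct js" "set js = u"
    using assms(1) by (auto simp: js_def)
  define ps where "ps = concat (map (\<lambda>j. map (Pair j) [1..<k j + 1]) js)"
  have set: "set ps = row_indices u k"
    using js by (auto simp: ps_def simp del: upt_Suc)
  have dist: "distinct ps"
    unfolding ps_def using js(1)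
    by (induction js) (auto simp: distinct_map inj_on_def simp del: upt_Suc)
  have map: "concat (map (\<lambda>j. map (gen_row m (C j)) [1..<k j + 1]) js) = map (net_row m C) ps"
    unfolding ps_def by (induction js) (auto simp del: upt_Suc)
  have len: "length ps = (\<Sum>j\<in>u. k j)"
    using length_stacked_rows[OF assms(1), of m C k] unfolding js_def[symmetric] map by simp
  have "net_row m C p \<in> carrier_vec m" if "p \<in> set ps" for p
    using that assms(2) gen_row_carrier unfolding set by auto
  then show ?thesis
    unfolding full_row_rank_def stacked_mat_def js_def[symmetric] map len[symmetric] set[symmetric]
    by (rule rank_mat_of_rows_eq_length_iff[OF dist])
qed

subsection \<open>Binary digits and gain factors\<close>

text \<open>The first \<open>k\<close> digits contribute an integer, the later ones a remainder in
  [0, 1). For \<open>k > m\<close> the missing digits count as 0.\<close>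

lemma floor_binary_expansion:
  fixes b :: "nat \<Rightarrow> bool"
  shows "\<lfloor>2 ^ k * (\<Sum>l = 1..m. of_bool (b l) / 2 ^ l :: real)\<rfloor> =
    (\<Sum>l = 1..k. of_bool (l \<le> m \<and> b l) * 2 ^ (k - l))"
proof -
  define x :: real where "x = (\<Sum>l = 1..m. of_bool (b l) / 2 ^ l)"
  define F :: "nat \<Rightarrow> int" where "F k = (\<Sum>l = 1..k. of_bool (l \<le> m \<and> b l) * 2 ^ (k - l))" for k
  define r :: "nat \<Rightarrow> real" where "r k = (\<Sum>l \<in> {k<..m}. of_bool (b l) * (2 ^ k / 2 ^ l))" for k
  \<comment> \<open>The inequality is strict because the expansion is finite: even with all digits
    1, the geometric sum stays below 1.\<close>
  have tail: "(\<Sum>l \<in> {k<..m}. 2 ^ k / 2 ^ l :: real) < 1" for k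
  proof (induction m)
    case (Suc m)
    have "(\<Sum>l \<in> {k<..m}. 2 ^ k / 2 ^ l :: real) = 1 - 2 ^ k / 2 ^ m" if "k \<le> m" for m
      using that
    proof (induction m rule: dec_induct)
      case (step m)
      then have "{k<..Suc m} = insert (Suc m) {k<..m}"
        by auto
      then show ?case
        using step by (simp add: field_simps)
    qed simp
    then show ?case
      by (cases "k \<le> Suc m") auto
  qed auto
  have "r k \<le> (\<Sum>l \<in> {k<..m}. 2 ^ k / 2 ^ l)"
    unfolding r_def by (rule sum_mono) auto
  then have r1: "r k < 1"
    using tail[of k] by linarith
  have r0: "0 \<le> r k"
    unfolding r_def by (rule sum_nonneg) auto
  have "2 ^ k * x = of_int (F k) + r k"
  proof -
    have "2 ^ k * x = (\<Sum>l = 1..m. of_bool (b l) * (2 ^ k / 2 ^ l))"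
      unfolding x_def sum_distrib_left by (rule sum.cong) auto
    also have "\<dots> = (\<Sum>l \<in> {1..m} \<inter> {..k}. of_bool (b l) * (2 ^ k / 2 ^ l)) + r k"
    proof -
      have "({1..m} \<inter> {..k}) \<union> {k<..m} = {1..m}"
        by auto
      then show ?thesis
        unfolding r_def by (subst sum.union_disjoint[symmetric]) auto
    qed
    also have "(\<Sum>l \<in> {1..m} \<inter> {..k}. of_bool (b l) * (2 ^ k / 2 ^ l)) = real_of_int (F k)"
      unfolding F_def of_int_sum
      by (rule sum.mono_neutral_cong_left) (auto simp: power_diff[where 'a = real])
    finally show ?thesis .
  qed
  then show ?thesis
    using r0 r1 unfolding x_def F_def by linarith
qed

text \<open>Induction on the depth: passing from \<open>k\<close> to \<open>Suc k\<close> doubles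
  the floor and appends one bit, and parity separates that bit from the rest.\<close>

lemma floor_binary_expansion_eq_iff:
  fixes a b :: "nat \<Rightarrow> bool"
  shows "\<lfloor>2 ^ k * (\<Sum>l = 1..m. of_bool (a l) / 2 ^ l :: real)\<rfloor> =
      \<lfloor>2 ^ k * (\<Sum>l = 1..m. of_bool (b l) / 2 ^ l :: real)\<rfloor> \<longleftrightarrow>
    (\<forall>l \<in> {1..k}. l \<le> m \<longrightarrow> a l = b l)"
proof -
  define F :: "(nat \<Rightarrow> bool) \<Rightarrow> nat \<Rightarrow> int" where
    "F b k = (\<Sum>l = 1..k. of_bool (l \<le> m \<and> b l) * 2 ^ (k - l))" for b k
  have F_Suc: "F b (Suc k) = 2 * F b k + of_bool (Suc k \<le> m \<and> b (Suc k))" for b k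
  proof -
    have "(\<Sum>l = 1..k. of_bool (l \<le> m \<and> b l) * 2 ^ (Suc k - l)) = 2 * F b k"
      unfolding F_def sum_distrib_left by (rule sum.cong) (auto simp: Suc_diff_le)
    then show ?thesis
      unfolding F_def[of b "Suc k"] by simp
  qed
  have "F a k = F b k \<longleftrightarrow> (\<forall>l \<in> {1..k}. l \<le> m \<longrightarrow> a l = b l)"
  proof (induction k)
    case 0
    then show ?case by (simp add: F_def)
  next
    case (Suc k)
    have last_bit: "2 * x + of_bool P = 2 * y + of_bool Q \<longleftrightarrow> x = y \<and> P = Q" for x y :: int and P Q
      by (cases P; cases Q) (auto, presburger+)
    have "F a (Suc k) = F b (Suc k) \<longleftrightarrow>
        (\<forall>l \<in> {1..k}. l \<le> m \<longrightarrow> a l = b l) \<and> (Suc k \<le> m \<longrightarrow> a (Suc k) = b (Suc k))"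
      unfolding F_Suc last_bit Suc by (cases "Suc k \<le> m") simp_all
    also have "\<dots> \<longleftrightarrow> (\<forall>l \<in> insert (Suc k) {1..k}. l \<le> m \<longrightarrow> a l = b l)"
      by blast
    also have "insert (Suc k) {1..k} = {1..Suc k}"
      by auto
    finally show ?case .
  qed
  then show ?thesis
    unfolding floor_binary_expansion F_def .
qed

text \<open>\<open>common_bits\<close> is the length of the longest initial segment on which
  \<open>Q\<close> holds, possibly infinite. It equals \<open>k\<close> exactly when
  \<open>Q\<close> holds up to \<open>k\<close> and fails at \<open>Suc k\<close>, which is the case
  with value -1.\<close>

lemma gain_factor_if_prefix_closed:
  assumes P: "\<And>k. \<lfloor>2 ^ k * x\<rfloor> = \<lfloor>2 ^ k * y\<rfloor> \<longleftrightarrow> (\<forall>l \<in> {1..k}. Q l)"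
  shows "gain_factor x y k =
    (\<Prod>l = 1..k. of_bool (Q l)) * (if Q (Suc k) then 1 else - 1)"
proof -
  have ge: "enat k \<le> common_bits x y \<longleftrightarrow> (\<forall>l \<in> {1..k}. Q l)" for k
  proof
    assume *: "enat k \<le> common_bits x y"
    show "\<forall>l \<in> {1..k}. Q l"
    proof (rule ccontr)
      assume n: "\<not> (\<forall>l \<in> {1..k}. Q l)"
      \<comment> \<open>Together with \<open>*\<close> this forces \<open>k = 0\<close> by truncated
        subtraction, and then the range in \<open>n\<close> is empty.\<close>
      have "common_bits x y \<le> enat (k - 1)"
        unfolding common_bits_def P
      proof (rule Sup_least)
        fix z assume "z \<in> {enat k |k. \<forall>l\<in>{1..k}. Q l}"
        then obtain i where i: "z = enat i" "\<forall>l\<in>{1..i}. Q l"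
          by blast
        with n have "\<not> k \<le> i"
          by (meson atLeastAtMost_iff order_trans)
        then show "z \<le> enat (k - 1)"
          using i by simp
      qed
      then have "enat k \<le> enat (k - 1)"
        using * order_trans by blast
      then have "k = 0"
        by simp
      then show False
        using n by simp
    qed
  next
    assume "\<forall>l \<in> {1..k}. Q l"
    then show "enat k \<le> common_bits x y"
      unfolding common_bits_def P by (intro Sup_upper) blast
  qed
  have lt: "common_bits x y < enat k \<longleftrightarrow> \<not> (\<forall>l \<in> {1..k}. Q l)"
    using ge[of k] by (simp add: not_le[symmetric])
  have "common_bits x y = enat k \<longleftrightarrow> enat k \<le> common_bits x y \<and> \<not> enat (Suc k) \<le> common_bits x y"
    by (cases "common_bits x y") auto
  then have eq: "common_bits x y = enat k \<longleftrightarrow> (\<forall>l \<in> {1..k}. Q l) \<and> \<not> Q (Suc k)"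
    unfolding ge by (auto simp: atLeastAtMostSuc_conv)
  have prod: "(\<Prod>l = 1..k. of_bool (Q l)) = (of_bool (\<forall>l \<in> {1..k}. Q l) :: real)"
    by (cases "\<forall>l \<in> {1..k}. Q l") (auto intro!: prod_zero)
  show ?thesis
    unfolding gain_factor_def lt eq prod by auto
qed

subsection \<open>Character sums\<close>

text \<open>The nontrivial additive character of the two-element field.\<close>

definition bit_sign :: "bit \<Rightarrow> real" where
  "bit_sign b = (if b = 0 then 1 else - 1)"

lemma bit_sign_add: "bit_sign (a + b) = bit_sign a * bit_sign b"
  by (cases a; cases b) (auto simp: bit_sign_def)

lemma bit_sign_sum: "bit_sign (\<Sum>p\<in>X. f p) = (\<Prod>p\<in>X. bit_sign (f p))"
  by (induction X rule: infinite_finite_induct) (auto simp: bit_sign_add, auto simp: bit_sign_def)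

lemma of_bool_eq_bit_sign: "of_bool (b = 0) = (1 + bit_sign b) / 2"
  by (auto simp: bit_sign_def)

lemma bit_vec_add_cancel:
  fixes v w :: "bit vec"
  assumes "v \<in> carrier_vec m" "w \<in> carrier_vec m"
  shows "v + (v + w) = w"
proof (rule eq_vecI)
  have cancel: "a + (a + b) = b" for a b :: bit
    by (cases a; cases b) simp_all
  show "(v + (v + w)) $ i = w $ i" if "i < dim_vec w" for i
    using assms that by (simp only: index_add_vec carrier_vecD cancel)
qed (use assms in simp)

lemma bij_betw_bit_vec_add:
  fixes v :: "bit vec"
  assumes "v \<in> carrier_vec m"
  shows "bij_betw ((+) v) (carrier_vec m) (carrier_vec m)"
  using assms by (intro bij_betw_byWitness[where f' = "(+) v"]) (auto simp: bit_vec_add_cancel)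

lemma bits_vec_carrier [simp]: "bits_vec m i \<in> carrier_vec m"
  by (simp add: bits_vec_def)

lemma bij_betw_bits_vec: "bij_betw (bits_vec m) {..<2 ^ m} (carrier_vec m)"
proof (rule bij_betw_imageI)
  show "inj_on (bits_vec m) {..<2 ^ m}"
  proof (rule inj_onI)
    fix i i' :: nat assume i: "i \<in> {..<2 ^ m}" "i' \<in> {..<2 ^ m}" and eq: "bits_vec m i = bits_vec m i'"
    have "bit i l = bit i' l" if "l < m" for l
    proof -
      have "(of_bool (bit i l) :: bit) = bits_vec m i $ l" "(of_bool (bit i' l) :: bit) = bits_vec m i' $ l"
        using that by (simp_all add: bits_vec_def bit_iff_odd)
      then show ?thesis
        using eq by (metis of_bool_eq_iff)
    qed
    then have "take_bit m i = take_bit m i'"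
      by (intro bit_eqI) (auto simp: bit_take_bit_iff)
    then show "i = i'"
      using i by (simp add: take_bit_nat_eq_self)
  qed
  show "bits_vec m ` {..<2 ^ m} = carrier_vec m"
  proof
    show "carrier_vec m \<subseteq> bits_vec m ` {..<2 ^ m}"
    proof
      fix v :: "bit vec" assume v: "v \<in> carrier_vec m"
      define i :: nat where "i = horner_sum of_bool 2 (map (\<lambda>l. v $ l = 1) [0..<m])"
      have "bit i l = (v $ l = 1)" if "l < m" for l
        using that by (simp add: i_def bit_horner_sum_bit_iff)
      then have "bits_vec m i = v"
        using v by (intro eq_vecI) (auto simp: bits_vec_def simp flip: bit_iff_odd)
      moreover have "i < 2 ^ m"
        using nat_horner_sum[of "map (\<lambda>l. v $ l = 1) [0..<m]"]
          horner_sum_of_bool_2_less[of "map (\<lambda>l. v $ l = 1) [0..<m]"]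
        by (simp add: i_def nat_less_iff)
      ultimately show "v \<in> bits_vec m ` {..<2 ^ m}"
        by blast
    qed
  qed auto
qed

text \<open>For each fixed \<open>i\<close>, translation by \<open>bits_vec m i\<close> permutes the
  whole space, so the inner sum does not depend on \<open>i\<close>. In characteristic 2 the sum of
  two digit vectors is also their difference.\<close>

lemma sum_bits_vec_add:
  fixes F :: "bit vec \<Rightarrow> real"
  shows "(\<Sum>i<2 ^ m. \<Sum>i'<2 ^ m. F (bits_vec m i + bits_vec m i')) =
    2 ^ m * (\<Sum>v\<in>carrier_vec m. F v)"
proof -
  have "(\<Sum>i'<2 ^ m. F (bits_vec m i + bits_vec m i')) = (\<Sum>v\<in>carrier_vec m. F v)" for i
    using sum.reindex_bij_betw[OF bij_betw_bits_vec, of "\<lambda>v. F (bits_vec m i + v)" m]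
      sum.reindex_bij_betw[OF bij_betw_bit_vec_add[of "bits_vec m i" m], of F] by simp
  then show ?thesis
    by simp
qed

text \<open>Orthogonality of characters: for nonzero \<open>w\<close>, translating by a unit vector
  where \<open>w\<close> has entry 1 flips every sign, so the sum equals its own negative.\<close>

lemma sum_bit_sign_scalar_prod:
  assumes w: "w \<in> carrier_vec m"
  shows "(\<Sum>v\<in>carrier_vec m. bit_sign (w \<bullet> v)) = (if w = 0\<^sub>v m then 2 ^ m else 0)"
proof (cases "w = 0\<^sub>v m")
  case True
  have "card (carrier_vec m :: bit vec set) = 2 ^ m"
    using bij_betw_same_card[OF bij_betw_bits_vec, of m] by simp
  with True show ?thesis
    by (simp add: bit_sign_def)
next
  case False
  then obtain c where c: "c < m" "w $ c = 1"
    using w by (auto simp: vec_eq_iff)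
  let ?e = "unit_vec m c :: bit vec"
  have "(\<Sum>v\<in>carrier_vec m. bit_sign (w \<bullet> v)) = (\<Sum>v\<in>carrier_vec m. bit_sign (w \<bullet> (?e + v)))"
    by (rule sum.reindex_bij_betw[OF bij_betw_bit_vec_add, symmetric]) simp
  also have "\<dots> = (\<Sum>v\<in>carrier_vec m. - bit_sign (w \<bullet> v))"
  proof (rule sum.cong)
    fix v :: "bit vec" assume "v \<in> carrier_vec m"
    then have "w \<bullet> (?e + v) = 1 + w \<bullet> v"
      using w c by (simp add: scalar_prod_add_distrib[of w m])
    then show "bit_sign (w \<bullet> (?e + v)) = - bit_sign (w \<bullet> v)"
      by (simp add: bit_sign_add) (simp add: bit_sign_def)
  qed simp
  also have "\<dots> = - (\<Sum>v\<in>carrier_vec m. bit_sign (w \<bullet> v))"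
    by (rule sum_negf)
  finally show ?thesis
    using False by simp
qed

lemma sum_prod_bit_sign:
  assumes f: "\<And>p. p \<in> X \<Longrightarrow> f p \<in> carrier_vec m"
  shows "(\<Sum>v\<in>carrier_vec m. \<Prod>p\<in>X. bit_sign (f p \<bullet> v)) = (if vanishing_sum m f X then 2 ^ m else 0)"
proof -
  define w where "w = vec m (\<lambda>c. \<Sum>p\<in>X. f p $ c)"
  have "(\<Prod>p\<in>X. bit_sign (f p \<bullet> v)) = bit_sign (w \<bullet> v)" if "v \<in> carrier_vec m" for v
  proof -
    have "w \<bullet> v = (\<Sum>c = 0..<m. \<Sum>p\<in>X. f p $ c * v $ c)"
      unfolding scalar_prod_def carrier_vecD[OF that]
      by (rule sum.cong) (simp_all only: w_def index_vec sum_distrib_right atLeastLessThan_iff)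
    also have "\<dots> = (\<Sum>p\<in>X. f p \<bullet> v)"
      unfolding scalar_prod_def carrier_vecD[OF that] by (rule sum.swap)
    finally have "w \<bullet> v = (\<Sum>p\<in>X. f p \<bullet> v)" .
    then show ?thesis
      by (simp add: bit_sign_sum)
  qed
  moreover have "w = 0\<^sub>v m \<longleftrightarrow> vanishing_sum m f X"
    by (auto simp: w_def vanishing_sum_def vec_eq_iff)
  ultimately show ?thesis
    using sum_bit_sign_scalar_prod[of w m] by (simp add: w_def)
qed

section \<open>Gain coefficients as counts of linear relations\<close>

abbreviation next_rows :: "nat set \<Rightarrow> (nat \<Rightarrow> nat) \<Rightarrow> (nat \<times> nat) set" where
  "next_rows u k \<equiv> (\<lambda>j. (j, Suc (k j))) ` u"

text \<open>By linearity, digit \<open>l\<close> of the two points agrees iff row \<open>l\<close>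
  annihilates the sum of the digit vectors. Indicators are written as
  \<open>(1 + bit_sign b) / 2\<close> to prepare for the character sums.\<close>

lemma gain_factor_net_point:
  assumes C: "C j \<in> carrier_mat m m"
  shows "gain_factor (net_point m C i j) (net_point m C i' j) k =
    (\<Prod>l = 1..k. (1 + bit_sign (net_row m C (j, l) \<bullet> (bits_vec m i + bits_vec m i'))) / 2) *
    bit_sign (net_row m C (j, Suc k) \<bullet> (bits_vec m i + bits_vec m i'))"
proof -
  let ?v = "bits_vec m i + bits_vec m i'"
  let ?Q = "\<lambda>l. gen_row m (C j) l \<bullet> ?v = 0"
  have Q: "?Q l \<longleftrightarrow> (l \<le> m \<longrightarrow> ((C j *\<^sub>v bits_vec m i) $ (l - 1) = 1) = ((C j *\<^sub>v bits_vec m i') $ (l - 1) = 1))"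
    if "l \<in> {1..k}" for l k
  proof (cases "l \<le> m")
    case True
    let ?r = "row (C j) (l - 1)"
    have r: "?r \<in> carrier_vec m"
      using C by auto
    have "l - 1 < dim_row (C j)"
      using True that C by auto
    then have "(C j *\<^sub>v bits_vec m i'') $ (l - 1) = ?r \<bullet> bits_vec m i''" for i''
      by (rule index_mult_mat_vec)
    moreover have "?r \<bullet> ?v = ?r \<bullet> bits_vec m i + ?r \<bullet> bits_vec m i'"
      using r by (intro scalar_prod_add_distrib[of _ m]) auto
    moreover have "a + b = 0 \<longleftrightarrow> (a = 1) = (b = 1)" for a b :: bit
      by (cases a; cases b) auto
    ultimately show ?thesis
      using True by (simp add: gen_row_def)
  \<comment> \<open>For \<open>l > m\<close> the zero row annihilates everything, matching the
    absence of digits beyond \<open>m\<close>.\<close>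
  qed (simp add: gen_row_def)
  have "\<lfloor>2 ^ k * net_point m C i j\<rfloor> = \<lfloor>2 ^ k * net_point m C i' j\<rfloor> \<longleftrightarrow> (\<forall>l \<in> {1..k}. ?Q l)" for k
    unfolding net_point_def floor_binary_expansion_eq_iff using Q by blast
  then have "gain_factor (net_point m C i j) (net_point m C i' j) k =
      (\<Prod>l = 1..k. of_bool (?Q l)) * (if ?Q (Suc k) then 1 else - 1)"
    by (rule gain_factor_if_prefix_closed)
  then show ?thesis
    by (simp add: of_bool_eq_bit_sign) (simp add: bit_sign_def)
qed

text \<open>Expanding the product of the factors \<open>1 + bit_sign\<close> gives one term per
  subset \<open>T\<close> of the rows; summed over all vectors, it survives, with value
  \<open>2 ^ m\<close>, exactly when \<open>T\<close> and the next rows together form a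
  relation.\<close>

lemma gain_eq_card_vanishing:
  assumes u: "finite u" and C: "\<And>j. j \<in> u \<Longrightarrow> C j \<in> carrier_mat m m"
  shows "gain m C u k = 2 ^ m / 2 ^ (\<Sum>j\<in>u. k j) *
    real (card {T. T \<subseteq> row_indices u k \<and> vanishing_sum m (net_row m C) (T \<union> next_rows u k)})"
proof -
  let ?I = "row_indices u k" and ?f = "net_row m C" and ?N = "next_rows u k"
  let ?s = "\<lambda>v p. bit_sign (?f p \<bullet> v)"
  have fin: "finite ?I"
    using u by auto
  have card: "card ?I = (\<Sum>j\<in>u. k j)"
    using u by (simp add: card_SigmaI)
  have expand: "(\<Prod>j\<in>u. (\<Prod>l = 1..k j. (1 + ?s v (j, l)) / 2) * ?s v (j, Suc (k j))) =
    1 / 2 ^ (\<Sum>j\<in>u. k j) * (\<Sum>T\<in>Pow ?I. \<Prod>p\<in>T \<union> ?N. ?s v p)" for v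
  proof -
    have "(\<Prod>j\<in>u. (\<Prod>l = 1..k j. (1 + ?s v (j, l)) / 2) * ?s v (j, Suc (k j))) =
        (\<Prod>j\<in>u. \<Prod>l = 1..k j. (1 + ?s v (j, l)) / 2) * (\<Prod>j\<in>u. ?s v (j, Suc (k j)))"
      by (rule prod.distrib)
    also have "(\<Prod>j\<in>u. \<Prod>l = 1..k j. (1 + ?s v (j, l)) / 2) = (\<Prod>p\<in>?I. (1 + ?s v p) / 2)"
      using u by (subst prod.Sigma) (auto intro!: prod.cong)
    also have "\<dots> = (\<Prod>p\<in>?I. ?s v p + 1) / 2 ^ (\<Sum>j\<in>u. k j)"
      by (simp only: prod_dividef prod_constant card add.commute)
    also have "(\<Prod>p\<in>?I. ?s v p + 1) = (\<Sum>T\<in>Pow ?I. \<Prod>p\<in>T. ?s v p)"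
      by (subst prod_add[OF fin]) simp
    also have "(\<Prod>j\<in>u. ?s v (j, Suc (k j))) = (\<Prod>p\<in>?N. ?s v p)"
      by (subst prod.reindex) (auto simp: inj_on_def)
    also have "(\<Sum>T\<in>Pow ?I. \<Prod>p\<in>T. ?s v p) / 2 ^ (\<Sum>j\<in>u. k j) * (\<Prod>p\<in>?N. ?s v p) =
        1 / 2 ^ (\<Sum>j\<in>u. k j) * (\<Sum>T\<in>Pow ?I. (\<Prod>p\<in>T. ?s v p) * (\<Prod>p\<in>?N. ?s v p))"
      by (simp add: sum_distrib_right)
    also have "(\<Sum>T\<in>Pow ?I. (\<Prod>p\<in>T. ?s v p) * (\<Prod>p\<in>?N. ?s v p)) = (\<Sum>T\<in>Pow ?I. \<Prod>p\<in>T \<union> ?N. ?s v p)"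
    proof (rule sum.cong)
      fix T assume "T \<in> Pow ?I"
      then have "finite T" "T \<inter> ?N = {}"
        using fin finite_subset by auto
      then show "(\<Prod>p\<in>T. ?s v p) * (\<Prod>p\<in>?N. ?s v p) = (\<Prod>p\<in>T \<union> ?N. ?s v p)"
        using u by (intro prod.union_disjoint[symmetric]) auto
    qed simp
    finally show ?thesis .
  qed
  have "gain m C u k = 1 / 2 ^ m * (\<Sum>i<2 ^ m. \<Sum>i'<2 ^ m.
      1 / 2 ^ (\<Sum>j\<in>u. k j) * (\<Sum>T\<in>Pow ?I. \<Prod>p\<in>T \<union> ?N. ?s (bits_vec m i + bits_vec m i') p))"
    unfolding gain_def expand[symmetric]
    using C by (intro arg_cong2[where f = "(*)"] refl sum.cong prod.cong gain_factor_net_point) auto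
  also have "\<dots> = (\<Sum>v\<in>carrier_vec m. 1 / 2 ^ (\<Sum>j\<in>u. k j) * (\<Sum>T\<in>Pow ?I. \<Prod>p\<in>T \<union> ?N. ?s v p))"
    by (subst sum_bits_vec_add[where F =
      "\<lambda>v. 1 / 2 ^ (\<Sum>j\<in>u. k j) * (\<Sum>T\<in>Pow ?I. \<Prod>p\<in>T \<union> ?N. ?s v p)"]) simp
  also have "\<dots> = 1 / 2 ^ (\<Sum>j\<in>u. k j) * (\<Sum>T\<in>Pow ?I. \<Sum>v\<in>carrier_vec m. \<Prod>p\<in>T \<union> ?N. ?s v p)"
    by (subst sum.swap) (simp add: sum_distrib_left)
  also have "(\<Sum>T\<in>Pow ?I. \<Sum>v\<in>carrier_vec m. \<Prod>p\<in>T \<union> ?N. ?s v p) =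
      (\<Sum>T\<in>Pow ?I. if vanishing_sum m ?f (T \<union> ?N) then 2 ^ m else 0)"
    using C gen_row_carrier by (intro sum.cong sum_prod_bit_sign) auto
  also have "\<dots> = 2 ^ m * real (card {T \<in> Pow ?I. vanishing_sum m ?f (T \<union> ?N)})"
    using fin by (subst sum.inter_filter[symmetric]) auto
  also have "{T \<in> Pow ?I. vanishing_sum m ?f (T \<union> ?N)} = {T. T \<subseteq> ?I \<and> vanishing_sum m ?f (T \<union> ?N)}"
    by auto
  finally show ?thesis
    by simp
qed

subsection \<open>Counting relations\<close>

text \<open>The symmetric difference is the sum of the two relations in characteristic 2, where the
  common part cancels.\<close>

lemma vanishing_sum_sym_diff:
  fixes f :: "'b \<Rightarrow> bit vec"
  assumes fin: "finite A" "finite B" and "vanishing_sum m f A" "vanishing_sum m f B"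
  shows "vanishing_sum m f ((A - B) \<union> (B - A))"
  unfolding vanishing_sum_def
proof (intro allI impI)
  fix c assume "c < m"
  let ?S = "\<lambda>X. \<Sum>p\<in>X. f p $ c"
  have A: "?S A = ?S (A \<inter> B) + ?S (A - B)"
    by (rule sum.Int_Diff[OF fin(1)])
  have B: "?S B = ?S (A \<inter> B) + ?S (B - A)"
    using sum.Int_Diff[OF fin(2), of "\<lambda>p. f p $ c" A] by (simp only: Int_commute)
  have zero: "?S A = 0" "?S B = 0"
    using assms \<open>c < m\<close> by (simp_all add: vanishing_sum_def)
  have "a + b = 0" if "0 = d + a" "0 = d + b" for a b d :: bit
    using that by (cases a; cases b; cases d) auto
  then have "?S (A - B) + ?S (B - A) = 0"
    using A B unfolding zero by blast
  moreover have "?S ((A - B) \<union> (B - A)) = ?S (A - B) + ?S (B - A)"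
    using fin by (intro sum.union_disjoint) auto
  ultimately show "?S ((A - B) \<union> (B - A)) = 0"
    by (simp only:)
qed

lemma independent_rows_mono:
  "independent_rows m f X \<Longrightarrow> Y \<subseteq> X \<Longrightarrow> independent_rows m f Y"
  unfolding independent_rows_def by (metis subset_trans)

text \<open>Two such relations with the same part outside \<open>J\<close> differ by a relation
  inside \<open>J\<close>, which is empty. Hence \<open>T \<mapsto> T - J\<close> is
  injective.\<close>

lemma card_vanishing_le:
  assumes fin: "finite I" "finite N" and disj: "I \<inter> N = {}" and ind: "independent_rows m f J"
  shows "card {T. T \<subseteq> I \<and> vanishing_sum m f (T \<union> N)} \<le> 2 ^ card (I - J)"
proof -
  let ?V = "{T. T \<subseteq> I \<and> vanishing_sum m f (T \<union> N)}"
  have "inj_on (\<lambda>T. T - J) ?V"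
  proof (rule inj_onI)
    fix S T assume S: "S \<in> ?V" and T: "T \<in> ?V" and eq: "S - J = T - J"
    let ?D = "((S \<union> N) - (T \<union> N)) \<union> ((T \<union> N) - (S \<union> N))"
    have "finite S" "finite T"
      using S T fin finite_subset by blast+
    then have "vanishing_sum m f ?D"
      using S T fin by (intro vanishing_sum_sym_diff) auto
    moreover have "?D \<subseteq> J"
      using eq by blast
    ultimately have "?D = {}"
      using ind unfolding independent_rows_def by blast
    then show "S = T"
      using S T disj by blast
  qed
  then have "card ?V \<le> card (Pow (I - J))"
    by (rule card_inj_on_le) (use fin in auto)
  then show ?thesis
    using fin by (simp add: card_Pow)
qed

text \<open>Greedy choice: one coordinate takes as much of \<open>c\<close> as it can, and the
  others share the remainder.\<close>

lemma exists_dominated_with_sum: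
  fixes k :: "'b \<Rightarrow> nat"
  assumes "finite u" "c \<le> (\<Sum>j\<in>u. k j)"
  shows "\<exists>k'. (\<forall>j\<in>u. k' j \<le> k j) \<and> (\<Sum>j\<in>u. k' j) = c"
  using assms
proof (induction u arbitrary: c rule: finite_induct)
  case (insert x F)
  have "c - min c (k x) \<le> (\<Sum>j\<in>F. k j)"
    using insert by auto
  then obtain k' where k': "\<forall>j\<in>F. k' j \<le> k j" "(\<Sum>j\<in>F. k' j) = c - min c (k x)"
    using insert.IH by blast
  have "(\<Sum>j\<in>F. (k'(x := min c (k x))) j) = (\<Sum>j\<in>F. k' j)"
    using insert.hyps by (intro sum.cong) auto
  then show ?case
    using k' insert.hyps by (intro exI[of _ "k'(x := min c (k x))"]) auto
qed simp

text \<open>This is the upper bound on the gain with denominators cleared. The independent set for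
  the count is \<open>row_indices v k'\<close>, where \<open>k'\<close> lies below \<open>k\<close>
  and has size \<open>\<kappa> - card u\<close>.\<close>

lemma card_vanishing_next_rows_le:
  assumes u: "finite u" and v: "v \<subseteq> u" "v \<noteq> {}" and less: "card u < \<kappa>"
    and ind: "\<And>k. (\<And>j. j \<in> u \<Longrightarrow> 1 \<le> k j) \<Longrightarrow> (\<Sum>j\<in>u. k j) < \<kappa> \<Longrightarrow>
      independent_rows m f (row_indices u k)"
  shows "card {T. T \<subseteq> row_indices v k \<and> vanishing_sum m f (T \<union> next_rows v k)} * 2 ^ \<kappa>
    \<le> 2 ^ ((\<Sum>j\<in>v. k j) + card u)"
proof (cases "{T. T \<subseteq> row_indices v k \<and> vanishing_sum m f (T \<union> next_rows v k)} = {}")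
  case False
  let ?V = "{T. T \<subseteq> row_indices v k \<and> vanishing_sum m f (T \<union> next_rows v k)}"
  have finv: "finite v"
    using u v finite_subset by blast
  have ext: "(\<Sum>j\<in>u. 1 + (if j \<in> v then h j else 0)) = card u + (\<Sum>j\<in>v. h j)" for h :: "nat \<Rightarrow> nat"
  proof -
    have "(\<Sum>j\<in>u. if j \<in> v then h j else 0) = (\<Sum>j\<in>v. h j)"
      using u v by (simp add: sum.inter_restrict[symmetric] Int_absorb1)
    then show ?thesis
      by (simp only: sum.distrib) simp
  qed
  \<comment> \<open>Adding 1 to every coordinate of \<open>u\<close>, with \<open>k\<close> extended
    by 0 off \<open>v\<close>, makes room for all next rows. If the resulting size were below
    \<open>\<kappa>\<close>, no relation could exist.\<close>
  have ge: "\<kappa> \<le> card u + (\<Sum>j\<in>v. k j)"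
  proof (rule ccontr)
    assume "\<not> \<kappa> \<le> card u + (\<Sum>j\<in>v. k j)"
    then have "independent_rows m f (row_indices u (\<lambda>j. 1 + (if j \<in> v then k j else 0)))"
      using ext[of k] by (intro ind) auto
    moreover obtain T where "T \<subseteq> row_indices v k" "vanishing_sum m f (T \<union> next_rows v k)"
      using False by blast
    moreover have "T \<union> next_rows v k \<subseteq> row_indices u (\<lambda>j. 1 + (if j \<in> v then k j else 0))"
      using \<open>T \<subseteq> row_indices v k\<close> v by fastforce
    ultimately have "T \<union> next_rows v k = {}"
      unfolding independent_rows_def by blast
    then show False
      using v by blast
  qed
  then have "\<kappa> - card u \<le> (\<Sum>j\<in>v. k j)"
    by linarith
  then obtain k' where k': "\<forall>j\<in>v. k' j \<le> k j" "(\<Sum>j\<in>v. k' j) = \<kappa> - card u"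
    using exists_dominated_with_sum[OF finv] by blast
  have "\<exists>j\<in>v. k' j \<noteq> 0"
  proof (rule ccontr)
    assume "\<not> (\<exists>j\<in>v. k' j \<noteq> 0)"
    then have "(\<Sum>j\<in>v. k' j) = 0"
      by simp
    then show False
      using k' less by simp
  qed
  then obtain j0 where j0: "j0 \<in> v" "k' j0 \<noteq> 0"
    by blast
  \<comment> \<open>The independence hypothesis needs entries at least 1. Using
    \<open>1 + k'\<close> would give size exactly \<open>\<kappa>\<close>; the maximum is strictly
    smaller at \<open>j0\<close>, so the size drops below \<open>\<kappa>\<close>.\<close>
  define k2 where "k2 j = max 1 (if j \<in> v then k' j else 0)" for j
  have "(\<Sum>j\<in>u. k2 j) < (\<Sum>j\<in>u. 1 + (if j \<in> v then k' j else 0))"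
    using u j0 v by (intro sum_strict_mono_ex1) (auto simp: k2_def intro!: bexI[of _ j0])
  then have "(\<Sum>j\<in>u. k2 j) < \<kappa>"
    unfolding ext k'(2) using less by simp
  then have "independent_rows m f (row_indices u k2)"
    by (intro ind) (auto simp: k2_def)
  moreover have "row_indices v k' \<subseteq> row_indices u k2"
    using v by (force simp: k2_def)
  ultimately have "independent_rows m f (row_indices v k')"
    by (rule independent_rows_mono)
  then have "card ?V \<le> 2 ^ card (row_indices v k - row_indices v k')"
    using finv by (intro card_vanishing_le) auto
  moreover have "card (row_indices v k - row_indices v k') = (\<Sum>j\<in>v. k j) - (\<kappa> - card u)"
  proof -
    have "row_indices v k' \<subseteq> row_indices v k"
      using k'(1) by force
    then show ?thesis
      using finv k'(2) by (subst card_Diff_subset) (auto simp: card_SigmaI)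
  qed
  ultimately have "card ?V * 2 ^ \<kappa> \<le> 2 ^ ((\<Sum>j\<in>v. k j) - (\<kappa> - card u)) * 2 ^ \<kappa>"
    by simp
  also have "\<dots> = 2 ^ ((\<Sum>j\<in>v. k j) + card u)"
    using ge less by (simp flip: power_add)
  finally show ?thesis .
next
  case True
  then show ?thesis
    by (simp only: card.empty)
qed

text \<open>This supplies the pair \<open>v\<close>, \<open>h\<close> at which the upper bound is
  attained: one relation suffices there, since \<open>h\<close> has size
  \<open>\<kappa> - card u\<close>.\<close>

lemma exists_vanishing_next_rows:
  assumes u: "finite u" and less: "card u < \<kappa>"
    and ind: "\<And>k. (\<And>j. j \<in> u \<Longrightarrow> 1 \<le> k j) \<Longrightarrow> (\<Sum>j\<in>u. k j) < \<kappa> \<Longrightarrow>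
      independent_rows m f (row_indices u k)"
    and k: "\<And>j. j \<in> u \<Longrightarrow> 1 \<le> k j" "(\<Sum>j\<in>u. k j) = \<kappa>" "\<not> independent_rows m f (row_indices u k)"
  obtains v h T where "v \<subseteq> u" "v \<noteq> {}" "h \<in> v \<rightarrow>\<^sub>E UNIV" "(\<Sum>j\<in>v. h j) + card u = \<kappa>"
    "T \<subseteq> row_indices v h" "vanishing_sum m f (T \<union> next_rows v h)"
proof -
  obtain S where S: "S \<subseteq> row_indices u k" "vanishing_sum m f S" "S \<noteq> {}"
    using k(3) unfolding independent_rows_def by blast
  \<comment> \<open>Otherwise lowering \<open>k j\<close> by one keeps all of \<open>S\<close>. The
    entry stays at least 1 because \<open>k j\<close> is at least 2, so the smaller index set is
    independent, a contradiction.\<close>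
  have last: "(j, k j) \<in> S" if j: "j \<in> u" "2 \<le> k j" for j
  proof (rule ccontr)
    assume notin: "(j, k j) \<notin> S"
    let ?k = "k(j := k j - 1)"
    have "(\<Sum>i\<in>u. ?k i) < (\<Sum>i\<in>u. k i)"
      using u j by (intro sum_strict_mono_ex1) (auto intro!: bexI[of _ j])
    then have "independent_rows m f (row_indices u ?k)"
      using k j by (intro ind) auto
    moreover have "S \<subseteq> row_indices u ?k"
    proof
      fix p assume p: "p \<in> S"
      obtain i l where il: "p = (i, l)"
        by (cases p)
      then have "i \<in> u" "1 \<le> l" "l \<le> k i"
        using p S(1) by auto
      moreover have "l \<noteq> k j" if "i = j"
        using p il notin that by blast
      ultimately show "p \<in> row_indices u ?k"
        unfolding il by auto
    qed
    ultimately show False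
      using S unfolding independent_rows_def by blast
  qed
  \<comment> \<open>Off \<open>v\<close>, \<open>last\<close> forces \<open>k j = 1\<close>, and
    that only row is not in \<open>S\<close>. So \<open>S\<close> lives over \<open>v\<close>, and
    \<open>k j - 1\<close> vanishes on the discarded coordinates.\<close>
  define v where "v = {j \<in> u. (j, k j) \<in> S}"
  define h where "h = (\<lambda>j\<in>v. k j - 1)"
  have k_one: "k j = 1" if "j \<in> u" "j \<notin> v" for j
    using k(1)[of j] last[of j] that by (fastforce simp: v_def)
  have sub: "v \<subseteq> u"
    by (auto simp: v_def)
  have "(\<Sum>j\<in>v. h j) = (\<Sum>j\<in>u. k j - 1)"
    using u sub k_one by (intro sum.mono_neutral_cong_left) (auto simp: h_def)
  moreover have "(\<Sum>j\<in>u. k j - 1) + card u = (\<Sum>j\<in>u. (k j - 1) + 1)"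
    by (simp only: sum.distrib sum_constant) simp
  moreover have "(\<Sum>j\<in>u. (k j - 1) + 1) = (\<Sum>j\<in>u. k j)"
    using k(1) by (intro sum.cong refl) (metis le_add_diff_inverse2)
  ultimately have sum: "(\<Sum>j\<in>v. h j) + card u = \<kappa>"
    using k(2) by simp
  then have "v \<noteq> {}"
    using less by auto
  have Suc_h: "Suc (h j) = k j" if "j \<in> v" for j
    using k(1)[of j] that by (simp add: v_def h_def)
  have next_sub: "next_rows v h \<subseteq> S"
  proof (rule image_subsetI)
    fix j assume "j \<in> v"
    then show "(j, Suc (h j)) \<in> S"
      unfolding Suc_h[OF \<open>j \<in> v\<close>] by (simp add: v_def)
  qed
  have "S - next_rows v h \<subseteq> row_indices v h"
  proof
    fix p assume p: "p \<in> S - next_rows v h"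
    obtain i l where il: "p = (i, l)"
      by (cases p)
    then have il': "i \<in> u" "1 \<le> l" "l \<le> k i" "(i, l) \<in> S"
      using p S(1) by auto
    have "i \<in> v"
    proof (rule ccontr)
      assume "i \<notin> v"
      then have "l = k i"
        using k_one[of i] il' by simp
      then show False
        using \<open>i \<notin> v\<close> il' by (simp add: v_def)
    qed
    moreover have "l \<noteq> k i"
    proof
      assume "l = k i"
      then have "p = (i, Suc (h i))"
        using il Suc_h[OF \<open>i \<in> v\<close>] by simp
      then show False
        using p \<open>i \<in> v\<close> by blast
    qed
    ultimately show "p \<in> row_indices v h"
      using il il' by (auto simp: h_def)
  qed
  moreover have "vanishing_sum m f ((S - next_rows v h) \<union> next_rows v h)"
    using S(2) next_sub by (simp add: Un_absorb2)
  ultimately show thesis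
    using that[of v h "S - next_rows v h"] sub \<open>v \<noteq> {}\<close> sum by (simp add: h_def)
qed

theorem theorem3:
  fixes m s :: nat and C :: "nat \<Rightarrow> bit mat" and u :: "nat set"
  assumes "m \<ge> 1" and "s \<ge> 1"
    and "\<And>j. j \<in> {1..s} \<Longrightarrow> C j \<in> carrier_mat m m"
    and "u \<subseteq> {1..s}" and "u \<noteq> {}"
    and "full_row_rank m C u (\<lambda>j\<in>u. 1)"
  shows "Max (gain m C u ` (u \<rightarrow>\<^sub>E UNIV)) \<le> 2 powi (t_star m C u + int (card u) - 1)
    \<and> Max ((\<lambda>v. Max (gain m C v ` (v \<rightarrow>\<^sub>E UNIV))) ` {v. v \<noteq> {} \<and> v \<subseteq> u})
        = 2 powi (t_star m C u + int (card u) - 1)"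
proof -
  have u: "finite u"
    using assms(4) finite_subset by blast
  have C: "C j \<in> carrier_mat m m" if "j \<in> u" for j
    using assms(3,4) that by blast
  let ?f = "net_row m C"
  define P where "P c \<longleftrightarrow> (\<exists>k \<in> u \<rightarrow>\<^sub>E UNIV. (\<forall>j\<in>u. 1 \<le> k j) \<and> \<not> full_row_rank m C u k \<and> (\<Sum>j\<in>u. k j) = c)" for c
  define \<kappa> where "\<kappa> = (LEAST c. P c)"
  define B :: real where "B = 2 powi (t_star m C u + int (card u) - 1)"
  have full_iff: "full_row_rank m C u k \<longleftrightarrow> independent_rows m ?f (row_indices u k)" for k
    by (rule full_row_rank_iff[where C = C, OF u C])
  obtain k0 where "k0 \<in> u \<rightarrow>\<^sub>E UNIV" "\<forall>j\<in>u. 1 \<le> k0 j" "\<not> full_row_rank m C u k0"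
    using ex_not_full_row_rank[OF u assms(5), of m C] by blast
  then have "P (\<Sum>j\<in>u. k0 j)"
    unfolding P_def by blast
  then have "P \<kappa>"
    unfolding \<kappa>_def by (rule LeastI)
  then obtain k where k: "k \<in> u \<rightarrow>\<^sub>E UNIV" "\<forall>j\<in>u. 1 \<le> k j" "\<not> full_row_rank m C u k" "(\<Sum>j\<in>u. k j) = \<kappa>"
    unfolding P_def by blast
  have ind: "independent_rows m ?f (row_indices u k)"
    if "\<And>j. j \<in> u \<Longrightarrow> 1 \<le> k j" "(\<Sum>j\<in>u. k j) < \<kappa>" for k
  proof (rule ccontr)
    assume "\<not> independent_rows m ?f (row_indices u k)"
    \<comment> \<open>The minimum ranges over extensional functions only, while the index set sees
      just the values on \<open>u\<close>.\<close>
    moreover have "row_indices u (restrict k u) = row_indices u k"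
      by auto
    ultimately have "\<not> full_row_rank m C u (restrict k u)"
      unfolding full_iff by simp
    then have "P (\<Sum>j\<in>u. k j)"
      unfolding P_def using that(1) by (intro bexI[of _ "restrict k u"]) auto
    then show False
      using not_less_Least that(2) unfolding \<kappa>_def by blast
  qed
  \<comment> \<open>Entries at least 1 with sum at most \<open>card u\<close> are all 1, which the
    full rank assumption excludes for a minimizer.\<close>
  have less: "card u < \<kappa>"
  proof (rule ccontr)
    assume "\<not> card u < \<kappa>"
    then have le: "(\<Sum>j\<in>u. k j) \<le> (\<Sum>j\<in>u. 1)"
      using k(4) by simp
    have "k j = 1" if "j \<in> u" for j
    proof (rule ccontr)
      assume "k j \<noteq> 1"
      then have "(\<Sum>j\<in>u. 1) < (\<Sum>j\<in>u. k j)"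
        using u k(2) that by (intro sum_strict_mono_ex1) (auto intro!: bexI[of _ j] simp: le_neq_implies_less)
      then show False
        using le by simp
    qed
    then have "k = (\<lambda>j\<in>u. 1)"
      using k(1) by (intro extensionalityI[of _ u]) (auto simp: PiE_iff)
    then show False
      using k(3) assms(6) by simp
  qed
  have B: "B = 2 ^ m * 2 ^ card u / 2 ^ \<kappa>"
  proof -
    have exponent: "t_star m C u + int (card u) - 1 = int m + int (card u) - int \<kappa>"
      unfolding t_star_def \<kappa>_def P_def by simp
    show ?thesis
      unfolding B_def exponent by (simp add: power_int_diff power_int_add)
  qed
  let ?V = "\<lambda>v k. {T. T \<subseteq> row_indices v k \<and> vanishing_sum m ?f (T \<union> next_rows v k)}"
  have gain: "gain m C v k = 2 ^ m / 2 ^ (\<Sum>j\<in>v. k j) * real (card (?V v k))" if "v \<subseteq> u" for v k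
    using that u C finite_subset by (intro gain_eq_card_vanishing) blast+
  have upper: "gain m C v k \<le> B" if "v \<noteq> {}" "v \<subseteq> u" for v k
  proof -
    have "real (card (?V v k) * 2 ^ \<kappa>) \<le> real (2 ^ ((\<Sum>j\<in>v. k j) + card u))"
      by (intro of_nat_mono card_vanishing_next_rows_le[OF u that(2,1) less ind])
    then have "real (card (?V v k)) * 2 ^ \<kappa> \<le> 2 ^ (\<Sum>j\<in>v. k j) * 2 ^ card u"
      by (simp add: power_add)
    then show ?thesis
      unfolding gain[OF that(2)] B by (simp add: field_simps)
  qed
  have Max_le: "Max (gain m C v ` (v \<rightarrow>\<^sub>E UNIV)) \<le> B" if "v \<noteq> {}" "v \<subseteq> u" for v
    using upper[OF that] by (intro Max.boundedI finite_gain_image) (auto simp: PiE_eq_empty_iff)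
  obtain v h T where v: "v \<subseteq> u" "v \<noteq> {}" "h \<in> v \<rightarrow>\<^sub>E UNIV" "(\<Sum>j\<in>v. h j) + card u = \<kappa>"
    "T \<subseteq> row_indices v h" "vanishing_sum m ?f (T \<union> next_rows v h)"
    using exists_vanishing_next_rows[OF u less ind, of k] k full_iff by blast
  \<comment> \<open>The single relation \<open>T\<close> makes the count at least 1, and by the size
    of \<open>h\<close> the prefactor alone is already \<open>B\<close>.\<close>
  have "B \<le> gain m C v h"
  proof -
    have "finite (row_indices v h)"
      using v(1) u by (auto intro: finite_subset)
    then have "finite (?V v h)"
      by (rule finite_subset[rotated, OF finite_Pow_iff[THEN iffD2]]) blast
    then have "1 \<le> card (?V v h)"
      using v(5,6) by (auto simp: Suc_le_eq card_gt_0_iff)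
    then have "2 ^ m / 2 ^ (\<Sum>j\<in>v. h j) * 1 \<le> gain m C v h"
      unfolding gain[OF v(1)] by (intro mult_left_mono) auto
    moreover have "B = 2 ^ m / 2 ^ (\<Sum>j\<in>v. h j)"
      unfolding B v(4)[symmetric] by (simp add: power_add)
    ultimately show ?thesis
      by simp
  qed
  also have "\<dots> \<le> Max (gain m C v ` (v \<rightarrow>\<^sub>E UNIV))"
    using v(3) by (intro Max_ge finite_gain_image) blast
  finally have "Max (gain m C v ` (v \<rightarrow>\<^sub>E UNIV)) = B"
    using Max_le v(1,2) by (intro antisym) auto
  then have "B \<in> (\<lambda>v. Max (gain m C v ` (v \<rightarrow>\<^sub>E UNIV))) ` {v. v \<noteq> {} \<and> v \<subseteq> u}"
    using v(1,2) by (metis (mono_tags, lifting) image_eqI mem_Collect_eq)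
  then have "Max ((\<lambda>v. Max (gain m C v ` (v \<rightarrow>\<^sub>E UNIV))) ` {v. v \<noteq> {} \<and> v \<subseteq> u}) = B"
    using u Max_le by (intro Max_eqI) auto
  then show ?thesis
    using Max_le[OF assms(5) subset_refl] unfolding B_def by blast
qed

end
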